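(* Let $\mathcal{V}$ be an input space, let $\mathcal{F}\subset\Delta(\mathcal{V})$ be any family of distributions over inputs and let $\mathcal{M}$ be any set of mechanisms. Then benchmark design is equivalent to prior-independent mechanism design, i.e. $\gamma=\beta$, where $$\beta=\min_{M\in\mathcal{M}}\max_{F\in\mathcal{F}}\frac{\mathrm{OPT}_F(F)}{M(F)},\qquad \gamma=\min_{B\in\mathcal{B}(\mathcal{F})}\ \min_{M\in\mathcal{M}}\ \max_{v\in\mathcal{V}}\frac{B(v)}{M(v)}.$$ Moreover, the optimal benchmark is given by the performance of the prior-independent optimal mechanism scaled up by its approximation ratio: if $M^*\in\mathcal{M}$ is an optimal solution of the program defining $\beta$ (with $\beta$ finite), then $B^*(v)=\beta\, M^*(v)$ belongs to $\mathcal{B}(\mathcal{F})$ and is an optimal benchmark for the program defining $\gamma$.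
   Context: A mechanism $M\in\mathcal{M}$ is represented by a function $\mathcal{V}\to[0,\infty)$, where $M(v)$ is its (expected) performance on input $v$. A benchmark is likewise a function $B:\mathcal{V}\to[0,\infty)$. For a distribution $F$ over $\mathcal{V}$ write $M(F)=\mathbf{E}_{v\sim F}[M(v)]$ and $B(F)=\mathbf{E}_{v\sim F}[B(v)]$. The Bayesian optimal mechanism for $F$ is $\mathrm{OPT}_F=\arg\max_{M\in\mathcal{M}}M(F)$, so $\mathrm{OPT}_F(F)=\max_{M\in\mathcal{M}}M(F)$. A benchmark $B$ is normalized for $\mathcal{F}$ (and $\mathcal{M}$) if $B(F)\ge \mathrm{OPT}_F(F)$ for all $F\in\mathcal{F}$; $\mathcal{B}(\mathcal{F})$ denotes the set of normalized benchmarks. The program for $\beta$ is the prior-independent mechanism design problem; the program for $\gamma$ is the benchmark design problem. Minima and maxima are read as infima and suprema if not attained, and a bound of the form $a/b\le\rho$ on a ratio is read as $a\le\rho\, b$. *)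

theory Defs
  imports "HOL-Probability.Probability"
begin

text \<open>
  The input space is a measurable space \<open>V\<close>, and the distributions over inputs are the elements of
  \<^term>\<open>space (prob_algebra V)\<close>. Expectations are taken in \<open>[0,\<infinity>]\<close>, so they always exist.
\<close>

definition performances :: "'v measure \<Rightarrow> ('v \<Rightarrow> real) set" where
  "performances V = {f \<in> borel_measurable V. \<forall>v\<in>space V. 0 \<le> f v}"

definition expected :: "('v \<Rightarrow> real) \<Rightarrow> 'v measure \<Rightarrow> ennreal" where
  "expected f F = (\<integral>\<^sup>+ v. ennreal (f v) \<partial>F)"

text \<open>The value \<open>OPT\<^sub>F(F)\<close> of the Bayesian optimal mechanism.\<close>

definition bayes_opt :: "('v \<Rightarrow> real) set \<Rightarrow> 'v measure \<Rightarrow> ennreal" where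
  "bayes_opt Mech F = (SUP M\<in>Mech. expected M F)"

definition normalized_benchmarks ::
    "'v measure \<Rightarrow> 'v measure set \<Rightarrow> ('v \<Rightarrow> real) set \<Rightarrow> ('v \<Rightarrow> real) set" where
  "normalized_benchmarks V Fam Mech =
     {B \<in> performances V. \<forall>F\<in>Fam. bayes_opt Mech F \<le> expected B F}"

text \<open>
  A bound \<open>a / b \<le> r\<close> on a ratio means \<open>a \<le> r * b\<close>. Division on \<^typ>\<open>ennreal\<close> has this property
  whenever \<open>b\<close> is finite, since there \<open>0 / 0 = 0\<close>, and \<open>a / 0 = \<infinity>\<close> for \<open>a \<noteq> 0\<close>.
\<close>

lemma ennreal_ratio_le_iff:
  fixes a b r :: ennreal
  assumes "b < \<infinity>" and "r < \<infinity>"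
  shows "a / b \<le> r \<longleftrightarrow> a \<le> r * b"
proof (cases "b = 0")
  case True
  then show ?thesis
    using assms by (cases "a = 0") (auto simp: top_unique)
next
  case False
  then have "a / b * b = a" and "r * b / b = r"
    using assms by (auto simp: ennreal_divide_times mult_divide_eq_ennreal)
  then show ?thesis
    by (metis divide_right_mono_ennreal mult_right_mono zero_le)
qed

definition approx_ratio :: "'v measure set \<Rightarrow> ('v \<Rightarrow> real) set \<Rightarrow> ('v \<Rightarrow> real) \<Rightarrow> ennreal" where
  "approx_ratio Fam Mech M = (SUP F\<in>Fam. bayes_opt Mech F / expected M F)"

definition prior_independent_value :: "'v measure set \<Rightarrow> ('v \<Rightarrow> real) set \<Rightarrow> ennreal" where
  "prior_independent_value Fam Mech = (INF M\<in>Mech. approx_ratio Fam Mech M)"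

definition resolution :: "'v measure \<Rightarrow> ('v \<Rightarrow> real) set \<Rightarrow> ('v \<Rightarrow> real) \<Rightarrow> ennreal" where
  "resolution V Mech B = (INF M\<in>Mech. SUP v\<in>space V. ennreal (B v) / ennreal (M v))"

definition benchmark_design_value ::
    "'v measure \<Rightarrow> 'v measure set \<Rightarrow> ('v \<Rightarrow> real) set \<Rightarrow> ennreal" where
  "benchmark_design_value V Fam Mech =
     (INF B\<in>normalized_benchmarks V Fam Mech. resolution V Mech B)"

text \<open>
  The last conjunct is the bound \<open>OPT\<^sub>F(F) / M(F) \<le> \<beta>\<close> in multiplied form. If \<open>\<beta>\<close> and all the \<open>M(F)\<close>
  are finite, it follows from the other two (lemma \<open>optimal_mechanism_iff\<close> below). It only matters
  when \<open>\<beta> = 0\<close> and some \<open>M(F) = \<infinity>\<close>: there \<open>OPT\<^sub>F(F) = \<infinity>\<close>, and \<open>OPT\<^sub>F(F) \<le> r * M(F)\<close> holds for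
  all \<open>r > 0\<close> but not for \<open>r = 0\<close>, so that \<open>M\<close> does not attain the infimum, while \<^typ>\<open>ennreal\<close> sets
  \<open>\<infinity> / \<infinity> = 0\<close>.
\<close>

definition optimal_mechanism ::
    "'v measure set \<Rightarrow> ('v \<Rightarrow> real) set \<Rightarrow> ('v \<Rightarrow> real) \<Rightarrow> bool" where
  "optimal_mechanism Fam Mech M \<longleftrightarrow>
     M \<in> Mech \<and>
     approx_ratio Fam Mech M = prior_independent_value Fam Mech \<and>
     (\<forall>F\<in>Fam. bayes_opt Mech F \<le> prior_independent_value Fam Mech * expected M F)"

lemma optimal_mechanism_iff:
  assumes fin: "\<And>F. F \<in> Fam \<Longrightarrow> expected M F < \<infinity>"
    and beta: "prior_independent_value Fam Mech < \<infinity>"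
  shows "optimal_mechanism Fam Mech M \<longleftrightarrow>
    M \<in> Mech \<and> approx_ratio Fam Mech M = prior_independent_value Fam Mech"
proof -
  have "bayes_opt Mech F \<le> prior_independent_value Fam Mech * expected M F"
    if eq: "approx_ratio Fam Mech M = prior_independent_value Fam Mech" and F: "F \<in> Fam" for F
  proof -
    have "bayes_opt Mech F / expected M F \<le> prior_independent_value Fam Mech"
      unfolding eq[symmetric] approx_ratio_def using F by (rule SUP_upper)
    then show ?thesis
      using ennreal_ratio_le_iff[OF fin[OF F] beta] by simp
  qed
  then show ?thesis
    unfolding optimal_mechanism_def by blast
qed

definition optimal_benchmark ::
    "'v measure \<Rightarrow> 'v measure set \<Rightarrow> ('v \<Rightarrow> real) set \<Rightarrow> ('v \<Rightarrow> real) \<Rightarrow> bool" where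
  "optimal_benchmark V Fam Mech B \<longleftrightarrow>
     B \<in> normalized_benchmarks V Fam Mech \<and>
     resolution V Mech B = benchmark_design_value V Fam Mech"

end

(* A pointwise bound B \<le> r M integrates to B(F) \<le> r M(F), so the resolution of a normalized
   benchmark is at least the approximation ratio of the mechanism that attains it. Conversely,
   if r bounds the approximation ratio of M, then r M is a normalized benchmark of resolution
   at most r. *)
theory Submission
  imports Defs
begin

text \<open>Passing from a product to a ratio is safe even at infinity:
  \<open>a / \<infinity>\<close> is 0, and an infinite \<open>r\<close> bounds everything. This
  matters because \<open>expected M F\<close> may be infinite. The converse direction fails
  there.\<close>

lemma ennreal_ratio_leI:
  fixes a b r :: ennreal
  assumes "a \<le> r * b"
  shows "a / b \<le> r"
proof (cases "b = \<infinity> \<or> r = \<infinity>")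
  case True
  then show ?thesis by auto
next
  case False
  then show ?thesis
    using assms ennreal_ratio_le_iff[of b r a] by (simp add: less_top)
qed

lemma scale_in_performances:
  assumes "M \<in> performances V" "0 \<le> r"
  shows "(\<lambda>v. r * M v) \<in> performances V"
  using assms by (auto simp: performances_def)

lemma expected_cmult:
  assumes F: "F \<in> space (prob_algebra V)" and M: "M \<in> performances V" and r: "0 \<le> r"
  shows "expected (\<lambda>v. r * M v) F = ennreal r * expected M F"
proof -
  have [measurable_cong]: "sets F = sets V"
    using F by (simp add: space_prob_algebra)
  have [measurable]: "M \<in> borel_measurable V"
    using M by (simp add: performances_def)
  show ?thesis
    unfolding expected_def using r by (simp add: ennreal_mult' nn_integral_cmult)
qed

lemma expected_mono:
  assumes "F \<in> space (prob_algebra V)" and "\<And>v. v \<in> space V \<Longrightarrow> f v \<le> g v"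
  shows "expected f F \<le> expected g F"
proof -
  have "space F = space V"
    using assms(1) by (auto simp: space_prob_algebra dest: sets_eq_imp_space_eq)
  then show ?thesis
    unfolding expected_def by (intro nn_integral_mono ennreal_leI) (simp add: assms(2))
qed

text \<open>\<open>M\<close> itself serves as the competing mechanism. Where \<open>M v = 0\<close>
  the ratio is \<open>0 / 0 = 0\<close>, so such inputs do no harm.\<close>

lemma resolution_scale_le:
  assumes "M \<in> Mech" "0 \<le> r"
  shows "resolution V Mech (\<lambda>v. r * M v) \<le> ennreal r"
  unfolding resolution_def using assms
  by (auto intro!: INF_lower2[of M] SUP_least ennreal_ratio_leI simp: ennreal_mult')

lemma prior_independent_value_le_resolution:
  assumes Fam: "Fam \<subseteq> space (prob_algebra V)" and Mech: "Mech \<subseteq> performances V"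
    and B: "B \<in> normalized_benchmarks V Fam Mech"
  shows "prior_independent_value Fam Mech \<le> resolution V Mech B"
  unfolding prior_independent_value_def resolution_def
\<comment> \<open>The infima are compared mechanism by mechanism: for each \<open>M\<close>, the
  worst ratio over inputs dominates the worst ratio over distributions.\<close>
proof (rule INF_mono)
  fix M assume M: "M \<in> Mech"
  define s where "s = (SUP v\<in>space V. ennreal (B v) / ennreal (M v))"
  have "approx_ratio Fam Mech M \<le> s"
  \<comment> \<open>An infinite \<open>s\<close> bounds everything. A finite one is a real factor
    \<open>r\<close>, so that the pointwise ratio bound can be multiplied out and
    integrated.\<close>
  proof (cases s)
    case (real r)
    have le: "B v \<le> r * M v" if v: "v \<in> space V" for v
    proof -
      have "ennreal (B v) / ennreal (M v) \<le> ennreal r"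
        unfolding real(2)[symmetric] s_def using v by (rule SUP_upper)
      then have "ennreal (B v) \<le> ennreal (r * M v)"
        using ennreal_ratio_le_iff[of "ennreal (M v)" "ennreal r"] real(1)
        by (simp add: ennreal_mult')
      \<comment> \<open>Since \<open>ennreal\<close> sends negative reals to 0, the inequality
        descends to the reals only with a nonnegative right-hand side.\<close>
      moreover have "0 \<le> r * M v"
        using M Mech v real(1) by (auto simp: performances_def)
      ultimately show ?thesis
        using ennreal_le_iff by blast
    qed
    have "bayes_opt Mech F / expected M F \<le> s" if F: "F \<in> Fam" for F
    proof (rule ennreal_ratio_leI)
      have "bayes_opt Mech F \<le> expected B F"
        using B F by (simp add: normalized_benchmarks_def)
      also have "\<dots> \<le> expected (\<lambda>v. r * M v) F"
        using Fam F le by (intro expected_mono) auto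
      also have "\<dots> = s * expected M F"
        unfolding real(2) using Fam F Mech M real(1) by (intro expected_cmult) auto
      finally show "bayes_opt Mech F \<le> s * expected M F" .
    qed
    then show ?thesis
      unfolding approx_ratio_def by (rule SUP_least)
  qed simp
  with M show "\<exists>N\<in>Mech. approx_ratio Fam Mech N \<le> (SUP v\<in>space V. ennreal (B v) / ennreal (M v))"
    unfolding s_def by blast
qed

text \<open>The bound is assumed as a product so that it stays meaningful when
  \<open>expected M F\<close> is infinite. It is applied both to factors strictly above the
  approximation ratio of \<open>M\<close> and to the optimal value itself.\<close>

lemma scale_normalized:
  assumes Fam: "Fam \<subseteq> space (prob_algebra V)" and Mech: "Mech \<subseteq> performances V"
    and M: "M \<in> Mech" and r: "0 \<le> r"
    and le: "\<And>F. F \<in> Fam \<Longrightarrow> bayes_opt Mech F \<le> ennreal r * expected M F"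
  shows "(\<lambda>v. r * M v) \<in> normalized_benchmarks V Fam Mech"
proof -
  have MV: "M \<in> performances V"
    using M Mech by auto
  have "bayes_opt Mech F \<le> expected (\<lambda>v. r * M v) F" if "F \<in> Fam" for F
    using that Fam le[OF that] expected_cmult[OF _ MV r, of F] by auto
  then show ?thesis
    unfolding normalized_benchmarks_def using scale_in_performances[OF MV r] by simp
qed

lemma benchmark_design_value_le_approx_ratio:
  assumes Fam: "Fam \<subseteq> space (prob_algebra V)" and Mech: "Mech \<subseteq> performances V"
    and M: "M \<in> Mech"
  shows "benchmark_design_value V Fam Mech \<le> approx_ratio Fam Mech M"
proof (rule dense_ge)
  (* Strictness makes the scaling factor positive, which covers M(F) = \<infinity>: there the ennreal
     ratio is 0 and says nothing about OPT(F). *)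
  fix s assume s: "approx_ratio Fam Mech M < s"
  show "benchmark_design_value V Fam Mech \<le> s"
  proof (cases s)
    case (real r)
    have pos: "0 < s"
      using s by (rule le_less_trans[OF zero_le])
    have "bayes_opt Mech F \<le> s * expected M F" if F: "F \<in> Fam" for F
    proof (cases "expected M F = \<infinity>")
      case True
      then show ?thesis
        using pos by (simp add: ennreal_mult_top)
    next
      case False
      have "bayes_opt Mech F / expected M F \<le> approx_ratio Fam Mech M"
        unfolding approx_ratio_def using F by (rule SUP_upper)
      with s have "bayes_opt Mech F / expected M F \<le> s"
        by simp
      then show ?thesis
        using ennreal_ratio_le_iff[of "expected M F" s] False real(2) by (simp add: less_top)
    qed
    then have "(\<lambda>v. r * M v) \<in> normalized_benchmarks V Fam Mech"
      using scale_normalized[OF Fam Mech M real(1)] real(2) by simp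
    then have "benchmark_design_value V Fam Mech \<le> resolution V Mech (\<lambda>v. r * M v)"
      unfolding benchmark_design_value_def by (rule INF_lower)
    also have "\<dots> \<le> s"
      unfolding real(2) using M real(1) by (rule resolution_scale_le)
    finally show ?thesis .
  qed simp
qed

theorem theorem1:
  fixes V :: "'v measure" and Fam :: "'v measure set" and Mech :: "('v \<Rightarrow> real) set"
  assumes "Fam \<subseteq> space (prob_algebra V)"
    and "Mech \<subseteq> performances V"
  shows "benchmark_design_value V Fam Mech = prior_independent_value Fam Mech \<and>
    (\<forall>M. optimal_mechanism Fam Mech M \<and> prior_independent_value Fam Mech < \<infinity> \<longrightarrow>
      (\<lambda>v. enn2real (prior_independent_value Fam Mech) * M v) \<in> normalized_benchmarks V Fam Mech \<and>
      optimal_benchmark V Fam Mech (\<lambda>v. enn2real (prior_independent_value Fam Mech) * M v))"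
proof (intro conjI allI impI)
  show eq: "benchmark_design_value V Fam Mech = prior_independent_value Fam Mech"
  proof (rule antisym)
    show "benchmark_design_value V Fam Mech \<le> prior_independent_value Fam Mech"
      unfolding prior_independent_value_def
      by (intro INF_greatest benchmark_design_value_le_approx_ratio assms)
    show "prior_independent_value Fam Mech \<le> benchmark_design_value V Fam Mech"
      unfolding benchmark_design_value_def
      by (intro INF_greatest prior_independent_value_le_resolution assms)
  qed
  fix M
  assume M: "optimal_mechanism Fam Mech M \<and> prior_independent_value Fam Mech < \<infinity>"
  define b where "b = enn2real (prior_independent_value Fam Mech)"
  \<comment> \<open>Finiteness of the optimal value enters here: \<open>enn2real\<close> would turn
    \<infinity> into 0.\<close>
  have b: "0 \<le> b" "prior_independent_value Fam Mech = ennreal b"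
    using M by (simp_all add: b_def less_top)
  \<comment> \<open>The factor is now exactly the optimal value, possibly 0, so there is no slack to
    absorb an infinite \<open>expected M F\<close>. The product form in
    \<open>optimal_mechanism\<close> supplies the bound instead.\<close>
  have MM: "M \<in> Mech"
    and opt: "\<And>F. F \<in> Fam \<Longrightarrow> bayes_opt Mech F \<le> ennreal b * expected M F"
    using M b(2) by (auto simp: optimal_mechanism_def)
  show norm: "(\<lambda>v. enn2real (prior_independent_value Fam Mech) * M v)
      \<in> normalized_benchmarks V Fam Mech"
    unfolding b_def[symmetric] by (rule scale_normalized[OF assms MM b(1) opt])
  then have "benchmark_design_value V Fam Mech
      \<le> resolution V Mech (\<lambda>v. enn2real (prior_independent_value Fam Mech) * M v)"
    unfolding benchmark_design_value_def by (rule INF_lower)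
  \<comment> \<open>The resolution is at most the scaling factor, which by \<open>eq\<close> is
    already the smallest value that a normalized benchmark can approach.\<close>
  moreover have "resolution V Mech (\<lambda>v. enn2real (prior_independent_value Fam Mech) * M v)
      \<le> benchmark_design_value V Fam Mech"
    using resolution_scale_le[OF MM b(1), of V] using b by (simp add: eq)
  ultimately show "optimal_benchmark V Fam Mech
      (\<lambda>v. enn2real (prior_independent_value Fam Mech) * M v)"
    using norm by (simp add: optimal_benchmark_def antisym)
qed

end
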